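(* Let $R_n$ be the total size of all chains in all plane trees with $n$ edges. Then $\sum_{n\ge0}R_nx^n=\frac{4B}{(3-B)^2}$, where $B=\frac{1}{\sqrt{1-4x}}$.
   Context: A plane tree is a rooted tree with linearly ordered children. A chain in a plane tree is a nonempty set of vertices all lying on a single path from the root to a leaf; its size is its number of vertices. $R_n=\sum |Q|$, summed over all pairs $(T,Q)$ with $T$ a plane tree with $n$ edges and $Q$ a chain of $T$. *)

theory Defs
  imports "HOL-Computational_Algebra.Computational_Algebra" "HOL-Library.Sublist"
begin

datatype plane_tree = Node "plane_tree list"

fun num_edges :: "plane_tree \<Rightarrow> nat" where
  "num_edges (Node ts) = (\<Sum>t\<leftarrow>ts. Suc (num_edges t))"

text \<open>A vertex is identified with its address: the list of child indices (from \<open>0\<close>) read along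
  the way from the root, whose own address is \<open>[]\<close>.  Thus the ancestors of a vertex, itself included,
  are the prefixes of its address.\<close>

fun is_vertex :: "plane_tree \<Rightarrow> nat list \<Rightarrow> bool" where
  "is_vertex T [] = True"
| "is_vertex (Node ts) (i # p) = (i < length ts \<and> is_vertex (ts ! i) p)"

definition vertices :: "plane_tree \<Rightarrow> nat list set" where
  "vertices T = {p. is_vertex T p}"

definition leaves :: "plane_tree \<Rightarrow> nat list set" where
  "leaves T = {p \<in> vertices T. \<forall>i. p @ [i] \<notin> vertices T}"

definition root_path :: "nat list \<Rightarrow> nat list set" where
  "root_path p = {q. prefix q p}"

definition chains :: "plane_tree \<Rightarrow> nat list set set" where
  "chains T = {Q. Q \<noteq> {} \<and> Q \<subseteq> vertices T \<and> (\<exists>l\<in>leaves T. Q \<subseteq> root_path l)}"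

definition total_chain_size :: "nat \<Rightarrow> nat" where
  "total_chain_size n = (\<Sum>(T, Q) \<in> {(T, Q). num_edges T = n \<and> Q \<in> chains T}. card Q)"

text \<open>A sum over an infinite set would be \<open>0\<close> by convention; the index set above is finite by
  \<open>finite_tree_chain_pairs\<close> below.\<close>

lemma vertices_Node:
  "vertices (Node ts) = insert [] (\<Union>i<length ts. Cons i ` vertices (ts ! i))"
proof (rule set_eqI)
  fix p show "p \<in> vertices (Node ts) \<longleftrightarrow> p \<in> insert [] (\<Union>i<length ts. Cons i ` vertices (ts ! i))"
    by (cases p) (auto simp: vertices_def)
qed

lemma vertices_finite_card: "finite (vertices T) \<and> card (vertices T) = Suc (num_edges T)"
proof (induction T)
  case (Node ts)
  have fin: "finite (vertices (ts ! i))" "card (vertices (ts ! i)) = Suc (num_edges (ts ! i))"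
    if "i < length ts" for i
    using Node.IH[of "ts ! i"] that by auto
  have "card (\<Union>i<length ts. Cons i ` vertices (ts ! i))
      = (\<Sum>i<length ts. card (Cons i ` vertices (ts ! i)))"
    by (rule card_UN_disjoint) (auto simp: fin)
  also have "\<dots> = (\<Sum>i<length ts. Suc (num_edges (ts ! i)))"
    by (rule sum.cong) (auto simp: card_image fin)
  also have "\<dots> = num_edges (Node ts)"
    by (simp only: num_edges.simps sum_list_sum_nth length_map)
       (auto simp: atLeast0LessThan intro!: sum.cong)
  finally show ?case
    by (subst (1 2) vertices_Node, subst card_insert_disjoint) (auto simp: fin)
qed

lemma finite_plane_trees_le: "finite {T. num_edges T \<le> n}"
proof (induction n rule: less_induct)
  case (less n)
  let ?S = "{T. num_edges T < n}"
  have "finite ?S"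
  proof (cases n)
    case (Suc m)
    then show ?thesis using less.IH[of m] by (simp add: less_Suc_eq_le)
  qed simp
  then have "finite {ts. set ts \<subseteq> ?S \<and> length ts \<le> n}"
    by (rule finite_lists_length_le)
  moreover have "{T. num_edges T \<le> n} \<subseteq> Node ` {ts. set ts \<subseteq> ?S \<and> length ts \<le> n}"
  proof
    fix T assume "T \<in> {T. num_edges T \<le> n}"
    moreover obtain ts where T: "T = Node ts" by (cases T)
    ultimately have le: "(\<Sum>t\<leftarrow>ts. Suc (num_edges t)) \<le> n" by simp
    have "Suc (num_edges t) \<le> (\<Sum>t\<leftarrow>ts. Suc (num_edges t))" if "t \<in> set ts" for t
      using that by (induction ts) auto
    moreover have "length ts \<le> (\<Sum>t\<leftarrow>ts. Suc (num_edges t))" by (induction ts) auto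
    ultimately show "T \<in> Node ` {ts. set ts \<subseteq> ?S \<and> length ts \<le> n}"
      unfolding T using le by (intro imageI) fastforce
  qed
  ultimately show ?case by (meson finite_imageI finite_subset)
qed

lemma finite_tree_chain_pairs: "finite {(T, Q). num_edges T = n \<and> Q \<in> chains T}"
proof (rule finite_subset)
  show "{(T, Q). num_edges T = n \<and> Q \<in> chains T}
      \<subseteq> Sigma {T. num_edges T \<le> n} (\<lambda>T. Pow (vertices T))"
    by (auto simp: chains_def)
  show "finite (Sigma {T. num_edges T \<le> n} (\<lambda>T. Pow (vertices T)))"
    using finite_plane_trees_le vertices_finite_card by blast
qed

end

theory Submission
  imports Defs
begin

text \<open>Removing the root from a chain of \<open>Node ts\<close> leaves either nothing or a chain of a single
  child subtree, so chain counts and total chain sizes satisfy linear recursions over \<open>ts\<close>.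
  Splitting off the first subtree, a tree is either a single vertex or a pair of trees joined by
  an edge. Hence, with \<open>C\<close>, \<open>D\<close>, \<open>S\<close> the generating functions of trees, of chains and of total
  chain sizes, \<open>C = 1 + xC\<^sup>2\<close>, \<open>D = 1 + 3xCD\<close> and \<open>S = 1 + xCD + 3xCS\<close>. With \<open>r = 1 - 2xC\<close> this
  gives \<open>r\<^sup>2 = 1 - 4x\<close> and \<open>S (1 - 3xC)\<^sup>2 = r\<close>, and \<open>3r - 1 = 2(1 - 3xC)\<close>.\<close>

section \<open>Chains and the first subtree\<close>

text \<open>Among the finitely many vertices extending \<open>p\<close>, one of maximal depth has no
  children.\<close>

lemma vertex_le_leaf:
  assumes "p \<in> vertices T"
  shows "\<exists>l\<in>leaves T. prefix p l"
proof -
  let ?P = "\<lambda>q. q \<in> vertices T \<and> prefix p q"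
  have "?P p" using assms by simp
  moreover have "\<forall>q. ?P q \<longrightarrow> length q < Suc (Max (length ` vertices T))"
    using vertices_finite_card[of T] by (auto simp: less_Suc_eq_le)
  ultimately have "\<exists>q. ?P q \<and> (\<forall>q'. ?P q' \<longrightarrow> length q' \<le> length q)"
    by (rule ex_has_greatest_nat[of ?P p length])
  then obtain q where q: "?P q" and max: "\<And>q'. ?P q' \<Longrightarrow> length q' \<le> length q"
    by metis
  have "q @ [i] \<notin> vertices T" for i
    using max[of "q @ [i]"] q by (auto simp: prefix_def)
  then show ?thesis
    using q by (auto simp: leaves_def)
qed

lemma vertices_prefix_closed: "is_vertex T q \<Longrightarrow> prefix p q \<Longrightarrow> is_vertex T p"
proof (induction T q arbitrary: p rule: is_vertex.induct)
  case (2 ts i q)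
  then show ?case by (cases p) auto
qed simp

text \<open>Allowing any vertex as the end of the path spares the recursion over subtrees from
  tracking leaves. Each vertex lies above a leaf, and vertices are closed under prefixes.\<close>

lemma chains_altdef: "chains T = {Q. Q \<noteq> {} \<and> (\<exists>p\<in>vertices T. Q \<subseteq> root_path p)}"
proof (intro equalityI subsetI)
  fix Q assume "Q \<in> chains T"
  then show "Q \<in> {Q. Q \<noteq> {} \<and> (\<exists>p\<in>vertices T. Q \<subseteq> root_path p)}"
    by (auto simp: chains_def leaves_def)
next
  fix Q assume "Q \<in> {Q. Q \<noteq> {} \<and> (\<exists>p\<in>vertices T. Q \<subseteq> root_path p)}"
  then obtain p where Q: "Q \<noteq> {}" and p: "p \<in> vertices T" "Q \<subseteq> root_path p"
    by blast
  obtain l where l: "l \<in> leaves T" "prefix p l"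
    using vertex_le_leaf p(1) by blast
  have "Q \<subseteq> vertices T"
    using p vertices_prefix_closed by (auto simp: root_path_def vertices_def)
  moreover have "Q \<subseteq> root_path l"
    using p(2) l(2) prefix_order.trans by (fastforce simp: root_path_def)
  ultimately show "Q \<in> chains T"
    using Q l(1) by (auto simp: chains_def)
qed

lemma root_path_Cons: "root_path (i # p) = insert [] (Cons i ` root_path p)"
  by (auto simp: root_path_def prefix_Cons)

lemma finite_chains: "finite (chains T)"
proof (rule finite_subset)
  show "chains T \<subseteq> Pow (vertices T)"
    by (auto simp: chains_def)
qed (use vertices_finite_card in blast)

lemma finite_chain: "Q \<in> chains T \<Longrightarrow> finite Q"
  using vertices_finite_card[of T] by (auto simp: chains_def intro: finite_subset)

lemma chain_nonempty: "Q \<in> chains T \<Longrightarrow> Q \<noteq> {}"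
  by (auto simp: chains_def)

text \<open>All nonempty prefixes of \<open>i # p\<close> start with \<open>i\<close>, so a chain
  enters at most one child subtree. The two images hold the chains without and with the
  root.\<close>

lemma chains_Node:
  "chains (Node ts) = insert {[]} (\<Union>i<length ts.
     (`) (Cons i) ` chains (ts ! i) \<union> (\<lambda>Q. insert [] (Cons i ` Q)) ` chains (ts ! i))"
  (is "?L = ?R")
proof (intro equalityI subsetI)
  fix Q assume "Q \<in> ?L"
  then obtain p where Q: "Q \<noteq> {}" and p: "p \<in> vertices (Node ts)" "Q \<subseteq> root_path p"
    by (auto simp: chains_altdef)
  show "Q \<in> ?R"
  proof (cases p)
    case Nil
    then show ?thesis using p Q by (auto simp: root_path_def)
  next
    case (Cons i p')
    have i: "i < length ts" "p' \<in> vertices (ts ! i)"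
      using p(1) Cons by (auto simp: vertices_def)
    have "Q - {[]} \<subseteq> Cons i ` root_path p'"
      using p(2) by (auto simp: Cons root_path_Cons)
    then obtain Q' where Q': "Q' \<subseteq> root_path p'" "Q - {[]} = Cons i ` Q'"
      by (meson subset_imageE)
    show ?thesis
    proof (cases "Q' = {}")
      case True
      then show ?thesis using Q Q' by auto
    next
      case False
      then have "Q' \<in> chains (ts ! i)"
        using Q' i by (auto simp: chains_altdef)
      moreover have "Q = Cons i ` Q' \<or> Q = insert [] (Cons i ` Q')"
        using Q'(2) by blast
      ultimately show ?thesis using i(1) by blast
    qed
  qed
next
  fix Q assume "Q \<in> ?R"
  then consider "Q = {[]}"
    | i Q' where "i < length ts" "Q' \<in> chains (ts ! i)"
        "Q = Cons i ` Q' \<or> Q = insert [] (Cons i ` Q')"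
    by blast
  then show "Q \<in> ?L"
  proof cases
    case 1
    have "[] \<in> vertices (Node ts)" by (simp add: vertices_def)
    with 1 show ?thesis unfolding chains_altdef by (auto simp: root_path_def)
  next
    case 2
    then obtain p where p: "p \<in> vertices (ts ! i)" "Q' \<subseteq> root_path p" "Q' \<noteq> {}"
      by (auto simp: chains_altdef)
    have "Q \<subseteq> root_path (i # p)" "Q \<noteq> {}"
      using 2(3) p by (auto simp: root_path_Cons)
    moreover have "i # p \<in> vertices (Node ts)"
      using 2(1) p by (auto simp: vertices_def)
    ultimately show ?thesis by (auto simp: chains_altdef)
  qed
qed

text \<open>The weight is arbitrary because adding the root shifts sizes by one, which changes the
  weight in the recursion. The weights used later are \<open>1\<close>, giving the number of chains,
  and \<open>real\<close>, giving their total size.\<close>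

definition chain_sum :: "(nat \<Rightarrow> real) \<Rightarrow> plane_tree \<Rightarrow> real" where
  "chain_sum f T = (\<Sum>Q\<in>chains T. f (card Q))"

lemma chain_sum_Node:
  "chain_sum f (Node ts) = f 1 + (\<Sum>t\<leftarrow>ts. chain_sum (\<lambda>k. f k + f (Suc k)) t)"
proof -
  let ?A = "\<lambda>i. (`) (Cons i) ` chains (ts ! i)"
  let ?B = "\<lambda>i. (\<lambda>Q. insert [] (Cons i ` Q)) ` chains (ts ! i)"
  let ?g = "\<lambda>Q. f (card Q)"
  have inj_ins: "inj_on (\<lambda>Q. insert [] (Cons i ` Q)) X" for i :: nat and X
  proof (rule inj_onI)
    fix Q Q' :: "nat list set"
    assume "insert [] (Cons i ` Q) = insert [] (Cons i ` Q')"
    then have "Cons i ` Q = Cons i ` Q'" by blast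
    then show "Q = Q'" by (simp add: inj_image_eq_iff)
  qed
  have inj_im: "inj_on ((`) (Cons i)) X" for i :: nat and X
    by (rule inj_onI) (simp add: inj_image_eq_iff)
  have sum_A: "sum ?g (?A i) = (\<Sum>Q\<in>chains (ts ! i). f (card Q))" for i
    by (simp add: sum.reindex inj_im card_image)
  have sum_B: "sum ?g (?B i) = (\<Sum>Q\<in>chains (ts ! i). f (Suc (card Q)))" for i
    by (subst sum.reindex[OF inj_ins], rule sum.cong)
       (auto simp: card_image card_insert_if finite_chain)
  have disj_AB: "?A i \<inter> ?B i = {}" for i by auto
  have sum_AB: "sum ?g (?A i \<union> ?B i) = chain_sum (\<lambda>k. f k + f (Suc k)) (ts ! i)" for i
    by (subst sum.union_disjoint)
       (use disj_AB in \<open>auto simp: finite_chains sum_A sum_B chain_sum_def sum.distrib\<close>)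
  have disj: "(?A i \<union> ?B i) \<inter> (?A j \<union> ?B j) = {}" if "i \<noteq> j" for i j
  proof -
    \<comment> \<open>A chain other than the root alone reveals its child index through any of its
      non-root vertices.\<close>
    have sub: "Q - {[]} \<noteq> {} \<and> Q - {[]} \<subseteq> range (Cons k)" if "Q \<in> ?A k \<union> ?B k" for Q k
      using that by (auto dest!: chain_nonempty)
    have False if Qi: "Q \<in> ?A i \<union> ?B i" and Qj: "Q \<in> ?A j \<union> ?B j" for Q
    proof -
      obtain q where "q \<in> Q - {[]}" using sub[OF Qi] by blast
      then have "q \<in> range (Cons i)" "q \<in> range (Cons j)"
        using sub[OF Qi] sub[OF Qj] by blast+
      then show False using \<open>i \<noteq> j\<close> by auto
    qed
    then show ?thesis by (meson disjoint_iff)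
  qed
  have root: "{[]} \<notin> (\<Union>i<length ts. ?A i \<union> ?B i)"
    by (auto dest!: chain_nonempty simp: insert_eq_iff)
  have "chain_sum f (Node ts) = f 1 + sum ?g (\<Union>i<length ts. ?A i \<union> ?B i)"
    unfolding chain_sum_def chains_Node
    by (subst sum.insert) (use root in \<open>auto simp: finite_chains\<close>)
  also have "sum ?g (\<Union>i<length ts. ?A i \<union> ?B i) = (\<Sum>i<length ts. sum ?g (?A i \<union> ?B i))"
    by (rule sum.UNION_disjoint) (use disj in \<open>auto simp: finite_chains\<close>)
  also have "\<dots> = (\<Sum>t\<leftarrow>ts. chain_sum (\<lambda>k. f k + f (Suc k)) t)"
    by (simp add: sum_AB sum_list_sum_nth atLeast0LessThan)
  finally show ?thesis .
qed

lemma chain_sum_Nil: "chain_sum f (Node []) = f 1"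
  by (simp add: chain_sum_Node)

lemma chain_sum_Cons:
  "chain_sum f (Node (t # ts)) = chain_sum (\<lambda>k. f k + f (Suc k)) t + chain_sum f (Node ts)"
  by (simp add: chain_sum_Node)

section \<open>Generating functions over plane trees\<close>

definition tree_gf :: "(plane_tree \<Rightarrow> real) \<Rightarrow> real fps" where
  "tree_gf w = Abs_fps (\<lambda>n. \<Sum>T | num_edges T = n. w T)"

lemma finite_plane_trees: "finite {T. num_edges T = n}"
  by (rule finite_subset[OF _ finite_plane_trees_le[of n]]) auto

lemma tree_gf_add: "tree_gf (\<lambda>T. v T + w T) = tree_gf v + tree_gf w"
  by (simp add: tree_gf_def fps_eq_iff sum.distrib)

lemma tree_gf_scale: "tree_gf (\<lambda>T. c * w T) = fps_const c * tree_gf w"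
  by (simp add: tree_gf_def fps_eq_iff sum_distrib_left)

lemma num_edges_eq_0_iff: "num_edges T = 0 \<longleftrightarrow> T = Node []"
proof (cases T)
  case (Node ts)
  then show ?thesis by (cases ts) auto
qed

text \<open>Cutting the edge to the first child is a bijection onto pairs of trees. That edge is the
  one removed by \<open>Suc\<close>, so the two parts share \<open>n\<close> edges.\<close>

lemma sum_trees_Suc:
  fixes w :: "plane_tree \<Rightarrow> real"
  shows "(\<Sum>T | num_edges T = Suc n. w T) =
    (\<Sum>i\<le>n. \<Sum>t | num_edges t = i. \<Sum>u | num_edges u = n - i.
       w (case u of Node ts \<Rightarrow> Node (t # ts)))"
proof -
  let ?join = "\<lambda>t u. case u of Node ts \<Rightarrow> Node (t # ts)"
  let ?I = "SIGMA i:{..n}. {t. num_edges t = i} \<times> {u. num_edges u = n - i}"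
  \<comment> \<open>\<open>hd\<close> and \<open>tl\<close> are meaningful here: a tree with
    \<open>Suc n\<close> edges has a first child.\<close>
  let ?split = "\<lambda>T. case T of Node ts \<Rightarrow> (num_edges (hd ts), hd ts, Node (tl ts))"
  have "(\<Sum>T | num_edges T = Suc n. w T) = (\<Sum>(i, t, u)\<in>?I. w (?join t u))"
  proof (rule sum.reindex_bij_witness[where i = "\<lambda>(i, t, u). ?join t u" and j = ?split])
    fix T assume "T \<in> {T. num_edges T = Suc n}"
    then obtain t ts where T: "T = Node (t # ts)" "num_edges (Node (t # ts)) = Suc n"
      by (cases T; cases "case T of Node ts \<Rightarrow> ts") auto
    show "(case ?split T of (i, t, u) \<Rightarrow> ?join t u) = T"
      and "(case ?split T of (i, t, u) \<Rightarrow> w (?join t u)) = w T"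
      by (simp_all add: T)
    show "?split T \<in> ?I"
      using T by simp
  next
    fix x assume "x \<in> ?I"
    then obtain t u where u: "x = (num_edges t, t, u)" "num_edges t \<le> n"
      "num_edges u = n - num_edges t"
      by auto
    obtain ts where "u = Node ts" by (cases u)
    with u have x: "x = (num_edges t, t, Node ts)" "num_edges t \<le> n"
      "num_edges (Node ts) = n - num_edges t"
      by auto
    show "?split (case x of (i, t, u) \<Rightarrow> ?join t u) = x"
      by (simp add: x)
    show "(case x of (i, t, u) \<Rightarrow> ?join t u) \<in> {T. num_edges T = Suc n}"
      using x by simp
  qed
  also have "\<dots> = (\<Sum>i\<le>n. \<Sum>t | num_edges t = i. \<Sum>u | num_edges u = n - i. w (?join t u))"
    by (simp add: sum.Sigma[symmetric] sum.cartesian_product[symmetric] finite_plane_trees)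
  finally show ?thesis .
qed

text \<open>Two products suffice for all three series: one term carries the chains of the first
  subtree, the other those of the remaining tree. The factor \<open>fps_X\<close> marks the joining
  edge.\<close>

lemma tree_gf_Cons:
  assumes "\<And>t ts. w (Node (t # ts)) = a t * b (Node ts) + c t * d (Node ts)"
  shows "tree_gf w = fps_const (w (Node []))
    + fps_X * (tree_gf a * tree_gf b + tree_gf c * tree_gf d)"
proof (rule fps_ext)
  fix n
  have w: "w (case u of Node ts \<Rightarrow> Node (t # ts)) = a t * b u + c t * d u" for t u
    by (cases u) (simp add: assms)
  show "tree_gf w $ n = (fps_const (w (Node []))
    + fps_X * (tree_gf a * tree_gf b + tree_gf c * tree_gf d)) $ n"
  proof (cases n)
    case 0
    then show ?thesis by (simp add: tree_gf_def num_edges_eq_0_iff)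
  next
    case (Suc m)
    have mult: "(tree_gf v * tree_gf v') $ m
      = (\<Sum>i\<le>m. \<Sum>t | num_edges t = i. \<Sum>u | num_edges u = m - i. v t * v' u)" for v v'
      by (simp add: tree_gf_def fps_mult_nth atLeast0AtMost sum_product)
    have "tree_gf w $ n = (tree_gf a * tree_gf b) $ m + (tree_gf c * tree_gf d) $ m"
      unfolding mult by (simp add: tree_gf_def Suc sum_trees_Suc w sum.distrib)
    then show ?thesis by (simp add: Suc)
  qed
qed

lemma total_chain_size_eq:
  "real (total_chain_size n) = (\<Sum>T | num_edges T = n. chain_sum real T)"
proof -
  have "{(T, Q). num_edges T = n \<and> Q \<in> chains T} = Sigma {T. num_edges T = n} chains"
    by auto
  then show ?thesis
    by (simp add: total_chain_size_def chain_sum_def sum.Sigma[symmetric] finite_plane_trees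
          finite_chains)
qed

theorem theorem6p3:
  fixes B :: "real fps"
  assumes "B = 1 / fps_radical root 2 (1 - 4 * fps_X)"
  shows "Abs_fps (\<lambda>n. real (total_chain_size n)) = 4 * B / (3 - B)\<^sup>2"
proof -
  define C where "C = tree_gf (\<lambda>_. 1)"
  define D where "D = tree_gf (chain_sum (\<lambda>_. 1))"
  define S where "S = tree_gf (chain_sum real)"
  define r where "r = 1 - 2 * fps_X * C"
  define q where "q = 1 - 3 * fps_X * C"
  \<comment> \<open>Counting trees needs only one product; the zero weights make the second
    vanish.\<close>
  have C: "C = 1 + fps_X * C\<^sup>2"
    using tree_gf_Cons[of "\<lambda>_. 1" "\<lambda>_. 1" "\<lambda>_. 1" "\<lambda>_. 0" "\<lambda>_. 0"] tree_gf_scale[of 0 "\<lambda>_. 0"]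
    by (simp add: C_def power2_eq_square)
  have two: "chain_sum (\<lambda>_. 2) t = 2 * chain_sum (\<lambda>_. 1) t" for t
    by (simp add: chain_sum_def)
  have D: "D = 1 + fps_X * (2 * D * C + C * D)"
    using tree_gf_Cons[of "chain_sum (\<lambda>_. 1)" "\<lambda>t. 2 * chain_sum (\<lambda>_. 1) t" "\<lambda>_. 1"
        "\<lambda>_. 1" "chain_sum (\<lambda>_. 1)"]
    by (simp add: chain_sum_Cons chain_sum_Nil two tree_gf_scale C_def D_def
          numeral_fps_const)
  \<comment> \<open>The shifted weight is k + (k + 1) = 2k + 1, which brings the number of chains
    into the equation for \<open>S\<close>.\<close>
  have "chain_sum (\<lambda>k. real k + real (Suc k)) t = 2 * chain_sum real t + chain_sum (\<lambda>_. 1) t" for t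
    by (simp add: chain_sum_def sum.distrib sum_distrib_left)
  then have S: "S = 1 + fps_X * ((2 * S + D) * C + C * S)"
    using tree_gf_Cons[of "chain_sum real" "\<lambda>t. 2 * chain_sum real t + chain_sum (\<lambda>_. 1) t"
        "\<lambda>_. 1" "\<lambda>_. 1" "chain_sum real"]
    by (simp add: chain_sum_Cons chain_sum_Nil tree_gf_add tree_gf_scale C_def D_def S_def
          numeral_fps_const)
  have Dq: "D * q = 1"
    using D unfolding q_def by algebra
  have Sq: "S * q\<^sup>2 = r"
  proof -
    have "S * q = 1 + fps_X * C * D"
      using S unfolding q_def by algebra
    \<comment> \<open>A second factor \<open>q\<close> eliminates \<open>D\<close>, since
      \<open>D * q = 1\<close>.\<close>
    then have "S * q\<^sup>2 = q + fps_X * C * (D * q)" by algebra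
    also have "\<dots> = r"
      unfolding Dq by (simp add: q_def r_def)
    finally show ?thesis .
  qed
  \<comment> \<open>Expanding gives 1 - 4x(C - xC^2), and the bracket is 1.\<close>
  have r_sq: "r\<^sup>2 = 1 - 4 * fps_X"
    using C unfolding r_def by algebra
  have r_0: "r $ 0 = 1"
    by (simp add: r_def mult.assoc)
  \<comment> \<open>The constant term 1 selects the right square root. The argument \<open>1\<close>
    of \<open>radical_unique\<close> stands for the exponent \<open>Suc 1\<close>.\<close>
  have r_rad: "r = fps_radical root 2 (1 - 4 * fps_X)"
    using radical_unique[of root 1 "1 - 4 * fps_X" r] r_sq r_0
    by (simp add: numeral_2_eq_2)
  have Br: "B * r = 1"
    using r_0 by (simp add: assms r_rad[symmetric] fps_divide_unit inverse_mult_eq_1)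
  have r_nz: "r \<noteq> 0"
    using r_0 by auto
  \<comment> \<open>Both sides equal 3r - 1. Squaring turns the equation for
    \<open>S * q\<^sup>2\<close> into one for \<open>S * (3 - B)\<^sup>2\<close>.\<close>
  have "(3 - B) * r = 2 * q"
    using Br unfolding q_def r_def by algebra
  then have "(S * (3 - B)\<^sup>2) * r\<^sup>2 = 4 * r"
    using Sq by algebra
  also have "\<dots> = (4 * B) * r\<^sup>2"
    using Br by algebra
  finally have eq: "S * (3 - B)\<^sup>2 = 4 * B"
    using r_nz by simp
  have "B \<noteq> 0"
    using Br by auto
  \<comment> \<open>If the square vanished, \<open>eq\<close> would force \<open>4 * B\<close> to be
    zero. Nonvanishing is what lets the division cancel.\<close>
  then have "(3 - B)\<^sup>2 \<noteq> 0"
    using eq by auto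
  then have "S = 4 * B / (3 - B)\<^sup>2"
    by (metis eq nonzero_mult_div_cancel_right)
  then show ?thesis
    by (simp add: S_def tree_gf_def total_chain_size_eq)
qed

end
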